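(* Let $X$ be a symplectic polytope in $\mathbb{R}^4$. Then the Reeb cones of the faces of $X$ satisfy the following: (1) If $E$ is a 3-face, then $R_E^+X$ consists of all nonnegative multiples of the Reeb vector field on $E$. (2) If $F$ is a 2-face, then $R_F^+X$ points into a 3-face $E$ adjacent to $F$, and agrees with $R_E^+X$. (3) If $L$ is a 1-face, then one of the following possibilities holds: either (good 1-face) $R_L^+X$ points into a 3-face $E$ adjacent to $L$ and agrees with $R_E^+X$; or (bad 1-face) $R_L^+X$ is tangent to $L$, and does not agree with $R_E^+X$ for any of the 3-faces $E$ adjacent to $L$. (4) If $P$ is a 0-face, then $R_P^+X$ points into a 3-face $E$ or a bad 1-face $L$ adjacent to $P$, and agrees with $R_E^+X$ or $R_L^+X$ respectively.
   Context: Identify $\mathbb{R}^{4}=\mathbb{C}^2$ with coordinates $z_j=x_j+\sqrt{-1}\,y_j$; $\mathbf{i}$ is the standard complex structure, $\langle\cdot,\cdot\rangle$ the Euclidean inner product, $\omega_0=\sum_{j=1}^2dx_j\wedge dy_j$. A convex polytope $X$ is a compact set that is the intersection of finitely many closed half-spaces. A $k$-face of $X$ is a $k$-dimensional subset $F\subset\partial X$ which is the (relative) interior of the intersection with $\partial X$ of some set of the hyperplanes defining $X$. A face $F$ is adjacent to a face $E$ of larger dimension if $F\subset\overline E$. For $y\in\partial X$: the tangent cone $T_y^+X$ is the closure of the set of vectors $v$ with $y+\epsilon v\in X$ for some $\epsilon>0$; the positive normal cone is $N_y^+X=\{v : \langle x-y,v\rangle\le 0\ \forall x\in X\}$; the Reeb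 cone is $R_y^+X=T_y^+X\cap \mathbf{i}N_y^+X$. These depend only on the face $F$ containing $y$ and are denoted $T_F^+X,N_F^+X,R_F^+X$. A symplectic polytope in $\mathbb{R}^4$ is a convex polytope with $0\in\operatorname{int}(X)$ such that $\omega_0$ restricts to a nonzero 2-form on each 2-face. For such $X$ every Reeb cone is one-dimensional (a ray). The Reeb vector field on a 3-face $E$ with outward unit normal $\nu$ is the constant vector $R_E=2\,\mathbf{i}\nu/\langle\nu,y\rangle$, where $y\in E$ is arbitrary. A ray at a face $F$ points into a face $E$ with $F\subset\overline E$, $F\ne E$, if its nonzero vectors lie in the interior (relative to the linear space $TE$ parallel to $E$) of the tangent cone $T_F^+\overline{E}$ of $\overline E$ at points of $F$. *)

theory Defs
  imports "HOL-Analysis.Analysis"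
begin

text \<open>The space \<open>R\<^sup>4 = C\<^sup>2\<close> is the type \<open>complex ^ 2\<close>; its library inner product is
  the real Euclidean one, and the complex structure is multiplication \<open>\<i> *s v\<close>.\<close>

definition omega0 :: "complex ^ 2 \<Rightarrow> complex ^ 2 \<Rightarrow> real" where
  "omega0 u v = (\<Sum>j\<in>UNIV. Re (u $ j) * Im (v $ j) - Im (u $ j) * Re (v $ j))"

definition convex_polytope :: "'a::euclidean_space set \<Rightarrow> bool" where
  "convex_polytope X \<longleftrightarrow> compact X \<and> polyhedron X"

definition halfspace_presentation :: "'a::euclidean_space set set \<Rightarrow> 'a set \<Rightarrow> bool" where
  "halfspace_presentation H X \<longleftrightarrow>
     finite H \<and> X = \<Inter> H \<and> (\<forall>h\<in>H. \<exists>a b. a \<noteq> 0 \<and> h = {x. a \<bullet> x \<le> b})"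

text \<open>The hyperplane belonging to a half-space \<open>h\<close> is \<open>frontier h\<close>. Every presentation of a
  full-dimensional polytope by half-spaces yields the same faces, so any presentation is admitted
  here. Faces are relatively open; the choice \<open>S = {}\<close> contributes none, since the boundary
  of a full-dimensional polytope has empty relative interior.\<close>

definition is_face :: "nat \<Rightarrow> 'a::euclidean_space set \<Rightarrow> 'a set \<Rightarrow> bool" where
  "is_face k X F \<longleftrightarrow>
     (\<exists>H. halfspace_presentation H X \<and>
        (\<exists>S\<subseteq>H. F = rel_interior (frontier X \<inter> (\<Inter>h\<in>S. frontier h)))) \<and>
     F \<subseteq> frontier X \<and> aff_dim F = int k"

definition adjacent :: "'a::euclidean_space set \<Rightarrow> 'a set \<Rightarrow> bool" where
  "adjacent F E \<longleftrightarrow> aff_dim F < aff_dim E \<and> F \<subseteq> closure E"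

definition tangent_space :: "'a::euclidean_space set \<Rightarrow> 'a set" where
  "tangent_space F = {x - y | x y. x \<in> affine hull F \<and> y \<in> affine hull F}"

definition tangent_cone :: "'a::euclidean_space set \<Rightarrow> 'a \<Rightarrow> 'a set" where
  "tangent_cone X y = closure {v. \<exists>\<epsilon>>0. y + \<epsilon> *\<^sub>R v \<in> X}"

definition normal_cone :: "'a::euclidean_space set \<Rightarrow> 'a \<Rightarrow> 'a set" where
  "normal_cone X y = {v. \<forall>x\<in>X. (x - y) \<bullet> v \<le> 0}"

definition reeb_cone :: "(complex ^ 2) set \<Rightarrow> complex ^ 2 \<Rightarrow> (complex ^ 2) set" where
  "reeb_cone X y = tangent_cone X y \<inter> (\<lambda>v. \<i> *s v) ` normal_cone X y"

text \<open>The common value of a function on a nonempty set on which it is constant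
  (unspecified if it is not constant).\<close>

definition value_on :: "'a set \<Rightarrow> ('a \<Rightarrow> 'b) \<Rightarrow> 'b" where
  "value_on F f = (THE c. \<forall>y\<in>F. f y = c)"

definition face_tangent_cone :: "'a::euclidean_space set \<Rightarrow> 'a set \<Rightarrow> 'a set" where
  "face_tangent_cone X F = value_on F (tangent_cone X)"

definition face_reeb_cone :: "(complex ^ 2) set \<Rightarrow> (complex ^ 2) set \<Rightarrow> (complex ^ 2) set" where
  "face_reeb_cone X F = value_on F (reeb_cone X)"

definition symplectic_polytope :: "(complex ^ 2) set \<Rightarrow> bool" where
  "symplectic_polytope X \<longleftrightarrow>
     convex_polytope X \<and> 0 \<in> interior X \<and>
     (\<forall>F. is_face 2 X F \<longrightarrow>
        (\<exists>u\<in>tangent_space F. \<exists>v\<in>tangent_space F. omega0 u v \<noteq> 0))"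

definition outward_unit_normal :: "'a::euclidean_space set \<Rightarrow> 'a set \<Rightarrow> 'a" where
  "outward_unit_normal X E =
     (THE \<nu>. norm \<nu> = 1 \<and> (\<forall>v\<in>tangent_space E. \<nu> \<bullet> v = 0) \<and>
             (\<forall>x\<in>X. \<forall>y\<in>E. \<nu> \<bullet> (x - y) \<le> 0))"

definition reeb_vector :: "(complex ^ 2) set \<Rightarrow> (complex ^ 2) set \<Rightarrow> complex ^ 2" where
  "reeb_vector X E =
     (let \<nu> = outward_unit_normal X E in value_on E (\<lambda>y. (2 / (\<nu> \<bullet> y)) *\<^sub>R (\<i> *s \<nu>)))"

definition is_ray :: "'a::real_vector set \<Rightarrow> bool" where
  "is_ray R \<longleftrightarrow> (\<exists>v. v \<noteq> 0 \<and> R = {t *\<^sub>R v | t. 0 \<le> t})"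

text \<open>Pointing into a face and being tangent to it are notions for rays, so both
  predicates include that the set in question is a (nondegenerate) ray.\<close>

definition points_into :: "'a::euclidean_space set \<Rightarrow> 'a set \<Rightarrow> 'a set \<Rightarrow> bool" where
  "points_into R F E \<longleftrightarrow>
     is_ray R \<and> F \<subseteq> closure E \<and> F \<noteq> E \<and>
     (\<forall>v\<in>R. v \<noteq> 0 \<longrightarrow>
        v \<in> top_of_set (tangent_space E) interior_of face_tangent_cone (closure E) F)"

definition tangent_to :: "'a::euclidean_space set \<Rightarrow> 'a set \<Rightarrow> bool" where
  "tangent_to R L \<longleftrightarrow> is_ray R \<and> R \<subseteq> tangent_space L"

definition good_1_face :: "(complex ^ 2) set \<Rightarrow> (complex ^ 2) set \<Rightarrow> bool" where
  "good_1_face X L \<longleftrightarrow> is_face 1 X L \<and>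
     (\<exists>E. is_face 3 X E \<and> adjacent L E \<and> points_into (face_reeb_cone X L) L E \<and>
          face_reeb_cone X L = face_reeb_cone X E)"

definition bad_1_face :: "(complex ^ 2) set \<Rightarrow> (complex ^ 2) set \<Rightarrow> bool" where
  "bad_1_face X L \<longleftrightarrow> is_face 1 X L \<and> tangent_to (face_reeb_cone X L) L \<and>
     (\<forall>E. is_face 3 X E \<and> adjacent L E \<longrightarrow> face_reeb_cone X L \<noteq> face_reeb_cone X E)"

end

theory Submission imports Defs
begin

text \<open>Write \<open>N\<close> for the normal cone at a boundary point \<open>y\<close> and \<open>T\<close> for the tangent cone. By the bipolar
theorem, \<open>T\<close> is the polar cone of \<open>N\<close>, so the Reeb cone consists of the vectors \<open>\<i> *s n\<close> with
\<open>n \<in> N\<close> and \<open>m \<bullet> (\<i> *s n) \<le> 0\<close> for all \<open>m \<in> N\<close>.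

Such an \<open>n \<noteq> 0\<close> always exists, because a hyperplane separating \<open>T\<close> from the rotation of a compact base
of \<open>N\<close> would have a normal in \<open>- N\<close> that is not orthogonal to its own rotation
(\<open>reeb_cone_nontrivial\<close>).

The main device is to follow this direction: for small \<open>\<epsilon> > 0\<close> the point \<open>x = y + \<epsilon> (\<i> *s n)\<close>
lies in \<open>X\<close>, and its normal cone is the part of \<open>N\<close> orthogonal to \<open>\<i> *s n\<close>. Since the
tangent space of a face is the orthogonal complement of its normal cone, \<open>\<i> *s n\<close> is tangent to the face
\<open>K\<close> containing \<open>x\<close>; moreover \<open>n\<close> is normal at \<open>x\<close>, so \<open>\<i> *s n\<close> is a Reeb direction there, and \<open>y\<close> lies in
the closure of \<open>K\<close>.

The symplectic hypothesis enters in one way: no 2-face is tangent to \<open>\<i> *s n\<close> for a nonzero vector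
\<open>n\<close> of its normal cone (\<open>reeb_direction_not_in_two_face\<close>). If there were two independent Reeb directions at
\<open>y\<close>, then following their sum would lead to exactly such a 2-face. Hence Reeb cones are rays
(\<open>reeb_cone_eq_ray\<close>), and the Reeb cone at \<open>x\<close> is the same as at \<open>y\<close>. The face \<open>K\<close> then has dimension 1 or 3
(\<open>reeb_step\<close>). If \<open>K\<close> is not the face of \<open>y\<close>, the Reeb cone points into \<open>K\<close>. If \<open>K\<close> is a
1-face, it is bad: its Reeb ray is tangent to it, and agreement with an adjacent 3-face would again
produce a forbidden 2-face between the two (\<open>tangent_reeb_direction_bad_1_face\<close>). Comparing
dimensions gives the list of cases for faces of dimension 0, 1 and 2. On a 3-face the normal cone is itself a
ray, and the Reeb cone is its rotation.\<close>

section \<open>Normal cones and tangent cones of convex sets\<close>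

lemma normal_cone_iff: "n \<in> normal_cone X y \<longleftrightarrow> (\<forall>x\<in>X. n \<bullet> x \<le> n \<bullet> y)"
  by (auto simp: normal_cone_def inner_diff_left inner_commute[of _ n])

text \<open>The points where \<open>n\<close> attains its maximum over \<open>X\<close> form a face that meets the relative interior of
\<open>G\<close> in \<open>y\<close>, and such a face contains all of \<open>G\<close>. Consequently the normal and tangent cones of \<open>X\<close>
depend only on the face, so that the common values chosen by \<open>value_on\<close> exist.\<close>

lemma normal_cone_constant_on_face:
  fixes X :: "'a::euclidean_space set"
  assumes "convex X" "G face_of X" "y \<in> rel_interior G" "n \<in> normal_cone X y" "z \<in> G"
  shows "n \<bullet> z = n \<bullet> y"
proof -
  let ?K = "X \<inter> {x. n \<bullet> x = n \<bullet> y}"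
  have "n \<bullet> x \<le> n \<bullet> y" if "x \<in> X" for x
    using assms(4) that by (auto simp: normal_cone_iff)
  then have "?K face_of X"
    using assms(1) face_of_Int_supporting_hyperplane_le by blast
  moreover have "G \<subseteq> X"
    using assms(2) face_of_imp_subset by blast
  moreover have "?K \<inter> rel_interior G \<noteq> {}"
    using assms(3) \<open>G \<subseteq> X\<close> rel_interior_subset by blast
  ultimately have "G \<subseteq> ?K"
    by (rule subset_of_face_of)
  then show ?thesis
    using assms(5) by blast
qed

lemma normal_cone_antimono_on_face:
  fixes X :: "'a::euclidean_space set"
  assumes "convex X" "G face_of X" "y \<in> rel_interior G" "z \<in> G"
  shows "normal_cone X y \<subseteq> normal_cone X z"
proof
  fix n assume n: "n \<in> normal_cone X y"
  then have "n \<bullet> z = n \<bullet> y"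
    using normal_cone_constant_on_face assms by blast
  with n show "n \<in> normal_cone X z"
    by (auto simp: normal_cone_iff)
qed

lemma normal_cone_eq_on_rel_interior:
  fixes X :: "'a::euclidean_space set"
  assumes "convex X" "G face_of X" "y \<in> rel_interior G" "z \<in> rel_interior G"
  shows "normal_cone X y = normal_cone X z"
  by (intro equalityI normal_cone_antimono_on_face[OF assms(1,2)] assms
      subsetD[OF rel_interior_subset])

text \<open>The bipolar theorem: the feasible directions form a convex cone \<open>C\<close> whose polar is the normal cone,
and a hyperplane separating a vector from the closure of \<open>C\<close> has, because \<open>C\<close> is a cone, a
normal that is an outward normal of \<open>X\<close> at \<open>y\<close>.\<close>

lemma tangent_cone_eq_polar:
  fixes X :: "'a::euclidean_space set"
  assumes "convex X" "y \<in> X"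
  shows "tangent_cone X y = {v. \<forall>n\<in>normal_cone X y. n \<bullet> v \<le> 0}"
proof -
  define C where "C = {v. \<exists>\<epsilon>>0. y + \<epsilon> *\<^sub>R v \<in> X}"
  \<comment> \<open>A feasible step may be shortened, so two feasible directions admit a common step length.\<close>
  have shrink: "y + \<delta> *\<^sub>R v \<in> X" if "y + \<epsilon> *\<^sub>R v \<in> X" "0 \<le> \<delta>" "\<delta> \<le> \<epsilon>" "0 < \<epsilon>" for v \<delta> \<epsilon>
  proof -
    have "(1 - \<delta>/\<epsilon>) *\<^sub>R y + (\<delta>/\<epsilon>) *\<^sub>R (y + \<epsilon> *\<^sub>R v) \<in> X"
      using that assms by (intro convexD) auto
    then show ?thesis
      using that by (simp add: algebra_simps)
  qed
  have "convex C"
  proof (rule convexI)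
    fix v w and s t :: real
    assume vw: "v \<in> C" "w \<in> C" "0 \<le> s" "0 \<le> t" "s + t = 1"
    then obtain e1 e2 where e: "e1 > 0" "y + e1 *\<^sub>R v \<in> X" "e2 > 0" "y + e2 *\<^sub>R w \<in> X"
      by (auto simp: C_def)
    define e where "e = min e1 e2"
    have "y + e *\<^sub>R v \<in> X" "y + e *\<^sub>R w \<in> X" "e > 0"
      using shrink[OF e(2), of e] shrink[OF e(4), of e] e unfolding e_def by auto
    then have "s *\<^sub>R (y + e *\<^sub>R v) + t *\<^sub>R (y + e *\<^sub>R w) \<in> X"
      using assms vw by (intro convexD) auto
    also have "s *\<^sub>R (y + e *\<^sub>R v) + t *\<^sub>R (y + e *\<^sub>R w) = (s + t) *\<^sub>R y + e *\<^sub>R (s *\<^sub>R v + t *\<^sub>R w)"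
      by (simp add: algebra_simps)
    finally have "y + e *\<^sub>R (s *\<^sub>R v + t *\<^sub>R w) \<in> X"
      using vw by simp
    then show "s *\<^sub>R v + t *\<^sub>R w \<in> C"
      using \<open>e > 0\<close> C_def by blast
  qed
  have "0 \<in> C"
    using assms by (auto simp: C_def intro: exI[of _ 1])
  have "closure C \<subseteq> {v. \<forall>n\<in>normal_cone X y. n \<bullet> v \<le> 0}"
  proof (rule closure_minimal)
    show "C \<subseteq> {v. \<forall>n\<in>normal_cone X y. n \<bullet> v \<le> 0}"
      by (force simp: C_def normal_cone_def inner_commute mult_le_0_iff)
    have "{v. \<forall>n\<in>normal_cone X y. n \<bullet> v \<le> 0} = (\<Inter>n\<in>normal_cone X y. {v. n \<bullet> v \<le> 0})"
      by blast
    then show "closed {v. \<forall>n\<in>normal_cone X y. n \<bullet> v \<le> 0}"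
      by (simp add: closed_halfspace_le closed_INT)
  qed
  moreover have "v \<in> closure C" if v: "\<forall>n\<in>normal_cone X y. n \<bullet> v \<le> 0" for v
  proof (rule ccontr)
    assume "v \<notin> closure C"
    then obtain a b where ab: "a \<bullet> v < b" "\<forall>x\<in>closure C. b < a \<bullet> x"
      using separating_hyperplane_closed_point[of "closure C" v] \<open>convex C\<close> by (auto simp: convex_closure)
    then have abC: "b < a \<bullet> x" if "x \<in> C" for x
      using that closure_subset by blast
    have "b < 0"
      using abC[OF \<open>0 \<in> C\<close>] by simp
    have "0 \<le> a \<bullet> (x - y)" if "x \<in> X" for x
    proof (rule ccontr)
      assume neg: "\<not> 0 \<le> a \<bullet> (x - y)"
      \<comment> \<open>This multiple of the feasible direction lies on the separating hyperplane.\<close>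
      define t where "t = b / (a \<bullet> (x - y))"
      have "t > 0"
        using neg \<open>b < 0\<close> by (simp add: t_def divide_neg_neg)
      have "y + (1/t) *\<^sub>R (t *\<^sub>R (x - y)) \<in> X"
        using that \<open>t > 0\<close> by simp
      then have "t *\<^sub>R (x - y) \<in> C"
        using \<open>t > 0\<close> unfolding C_def by (metis (mono_tags, lifting) mem_Collect_eq zero_less_divide_1_iff)
      then have "b < a \<bullet> (t *\<^sub>R (x - y))"
        by (rule abC)
      then show False
        using neg by (simp add: t_def)
    qed
    then have "- a \<in> normal_cone X y"
      by (simp add: normal_cone_def inner_commute)
    then show False
      using v ab \<open>b < 0\<close> by fastforce
  qed
  ultimately show ?thesis
    unfolding tangent_cone_def C_def by blast
qed

lemma tangent_cone_eq_on_rel_interior: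
  fixes X :: "'a::euclidean_space set"
  assumes "convex X" "G face_of X" "y \<in> rel_interior G" "z \<in> rel_interior G"
  shows "tangent_cone X y = tangent_cone X z"
proof -
  have "y \<in> X" "z \<in> X"
    using assms face_of_imp_subset rel_interior_subset by blast+
  then show ?thesis
    using normal_cone_eq_on_rel_interior[OF assms] assms(1) by (simp add: tangent_cone_eq_polar)
qed

lemma value_on_eq:
  assumes "y \<in> F" "\<And>z. z \<in> F \<Longrightarrow> f z = f y"
  shows "value_on F f = f y"
  unfolding value_on_def
proof (rule the_equality)
  show "\<forall>z\<in>F. f z = f y"
    using assms(2) by blast
  show "c = f y" if "\<forall>z\<in>F. f z = c" for c
    using that assms(1) by simp
qed

section \<open>Polyhedra near a boundary point\<close>

text \<open>For a polyhedron the cone of feasible directions is already closed: of the finitely many defining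
inequalities, those that are strict at \<open>y\<close> survive a short step, and the normals of the others lie
in the normal cone.\<close>

lemma polyhedron_feasible_direction:
  fixes X :: "'a::euclidean_space set"
  assumes "polyhedron X" "y \<in> X" "\<forall>n\<in>normal_cone X y. n \<bullet> v \<le> 0"
  obtains \<epsilon> where "\<epsilon> > 0" "y + \<epsilon> *\<^sub>R v \<in> X"
proof -
  obtain H where H: "finite H" "X = \<Inter>H" "\<forall>h\<in>H. \<exists>a b. a \<noteq> 0 \<and> h = {x. a \<bullet> x \<le> b}"
    using assms(1) by (auto simp: polyhedron_def)
  have "\<forall>h\<in>H. \<forall>\<^sub>F e in at_right 0. y + e *\<^sub>R v \<in> h"
  proof
    fix h assume "h \<in> H"
    then obtain a b where ab: "h = {x. a \<bullet> x \<le> b}"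
      using H by blast
    have le: "\<And>x. x \<in> X \<Longrightarrow> a \<bullet> x \<le> b"
      using H(2) \<open>h \<in> H\<close> ab by blast
    show "\<forall>\<^sub>F e in at_right 0. y + e *\<^sub>R v \<in> h"
    proof (cases "a \<bullet> y = b")
      case True
      then have "a \<in> normal_cone X y"
        using le by (auto simp: normal_cone_iff)
      then have "a \<bullet> v \<le> 0"
        using assms(3) by blast
      then show ?thesis
        using True ab by (auto simp: eventually_at_filter inner_add_right mult_le_0_iff)
    next
      case False
      then have "a \<bullet> y < b"
        using le[OF assms(2)] by simp
      moreover have "((\<lambda>e. a \<bullet> (y + e *\<^sub>R v)) \<longlongrightarrow> a \<bullet> (y + 0 *\<^sub>R v)) (at_right 0)"
        by (intro tendsto_intros)
      ultimately have "\<forall>\<^sub>F e in at_right 0. a \<bullet> (y + e *\<^sub>R v) < b"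
        by (simp add: order_tendstoD(2))
      then show ?thesis
        using ab by (auto elim: eventually_mono)
    qed
  qed
  then have "\<forall>\<^sub>F e in at_right 0. \<forall>h\<in>H. y + e *\<^sub>R v \<in> h"
    using H(1) by (rule eventually_ball_finite[rotated])
  then have "\<forall>\<^sub>F e in at_right (0::real). y + e *\<^sub>R v \<in> X \<and> 0 < e"
    using H(2) by (intro eventually_conj) (auto simp: eventually_at_right_less)
  then show thesis
    using that eventually_happens[of _ "at_right (0::real)"] by auto
qed

text \<open>The unique face of \<open>X\<close> containing \<open>x\<close> in its relative interior, when \<open>X\<close> is a polyhedron.\<close>

definition carrier_face :: "'a::euclidean_space set \<Rightarrow> 'a \<Rightarrow> 'a set" where
  "carrier_face X x = {z\<in>X. \<forall>n\<in>normal_cone X x. n \<bullet> (z - x) = 0}"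

lemma carrier_face_face_of:
  fixes X :: "'a::euclidean_space set"
  assumes "convex X" "x \<in> X"
  shows "carrier_face X x face_of X"
proof -
  have "normal_cone X x \<noteq> {}"
    by (auto simp: normal_cone_def intro: exI[of _ 0])
  have "(X \<inter> {z. n \<bullet> z = n \<bullet> x}) face_of X" if "n \<in> normal_cone X x" for n
    using that by (intro face_of_Int_supporting_hyperplane_le assms)
      (auto simp: normal_cone_iff)
  then have "(\<Inter>n\<in>normal_cone X x. X \<inter> {z. n \<bullet> z = n \<bullet> x}) face_of X"
    using \<open>normal_cone X x \<noteq> {}\<close> by (intro face_of_Inter) auto
  moreover have "(\<Inter>n\<in>normal_cone X x. X \<inter> {z. n \<bullet> z = n \<bullet> x}) = carrier_face X x"
    using \<open>normal_cone X x \<noteq> {}\<close> by (auto simp: carrier_face_def inner_diff_right)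
  ultimately show ?thesis
    by simp
qed

text \<open>A segment in the carrier face that ends in \<open>x\<close> can be prolonged beyond \<open>x\<close>, since the opposite
direction is also orthogonal to the normal cone and hence feasible.\<close>

lemma in_rel_interior_carrier_face:
  fixes X :: "'a::euclidean_space set"
  assumes "polyhedron X" "x \<in> X"
  shows "x \<in> rel_interior (carrier_face X x)"
proof -
  let ?G = "carrier_face X x"
  have "x \<in> ?G"
    using assms by (simp add: carrier_face_def)
  moreover have "convex ?G"
    using face_of_imp_convex[OF carrier_face_face_of[OF polyhedron_imp_convex]] assms by blast
  moreover have "\<exists>e>1. (1 - e) *\<^sub>R z + e *\<^sub>R x \<in> ?G" if "z \<in> ?G" for z
  proof -
    have 0: "\<forall>n\<in>normal_cone X x. n \<bullet> (x - z) = 0"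
      using that by (auto simp: carrier_face_def inner_diff_right)
    then obtain e where e: "e > 0" "x + e *\<^sub>R (x - z) \<in> X"
      using polyhedron_feasible_direction[OF assms, of "x - z"] by auto
    then have "x + e *\<^sub>R (x - z) \<in> ?G"
      using 0 by (simp add: carrier_face_def)
    moreover have "x + e *\<^sub>R (x - z) = (1 - (1 + e)) *\<^sub>R z + (1 + e) *\<^sub>R x"
      by (simp add: algebra_simps)
    ultimately show ?thesis
      using e(1) by (intro exI[of _ "1 + e"]) auto
  qed
  ultimately show ?thesis
    using convex_rel_interior_iff by blast
qed

lemma carrier_face_unique:
  fixes X :: "'a::euclidean_space set"
  assumes "polyhedron X" "G face_of X" "x \<in> rel_interior G"
  shows "carrier_face X x = G"
proof -
  have "x \<in> X"
    using assms face_of_imp_subset rel_interior_subset by blast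
  then show ?thesis
    using face_of_eq[OF carrier_face_face_of assms(2)] in_rel_interior_carrier_face[OF assms(1)]
      assms polyhedron_imp_convex by blast
qed

lemma tangent_space_eq:
  assumes "y \<in> affine hull F"
  shows "tangent_space F = {u. y + u \<in> affine hull F}"
proof -
  have "y + (p - q) \<in> affine hull F" if "p \<in> affine hull F" "q \<in> affine hull F" for p q
    using mem_affine_3_minus[OF affine_affine_hull assms that, of 1] by simp
  moreover have "u = (y + u) - y" for u
    by simp
  ultimately show ?thesis
    using assms unfolding tangent_space_def by (auto; blast)
qed

lemma tangent_space_rel_interior:
  assumes "convex G"
  shows "tangent_space (rel_interior G) = tangent_space G"
  using assms by (simp add: tangent_space_def rel_interior_same_affine_hull)

text \<open>The normal cone of a face spans the orthogonal complement of its tangent space. This is how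
dimensions of faces are read off from normal cones: a direction orthogonal to all normals is
feasible and stays within the carrier face.\<close>

lemma tangent_space_eq_normal_cone_orthogonal:
  fixes X :: "'a::euclidean_space set"
  assumes "polyhedron X" "G face_of X" "y \<in> rel_interior G"
  shows "tangent_space G = {u. \<forall>n\<in>normal_cone X y. n \<bullet> u = 0}"
proof -
  have cX: "convex X"
    using assms polyhedron_imp_convex by blast
  have yG: "y \<in> G"
    using assms rel_interior_subset by blast
  then have yX: "y \<in> X"
    using assms face_of_imp_subset by blast
  have eq: "tangent_space G = {u. y + u \<in> affine hull G}"
    using yG by (intro tangent_space_eq) (simp add: hull_inc)
  have "n \<bullet> u = 0" if "y + u \<in> affine hull G" "n \<in> normal_cone X y" for n u
  proof -
    have "G \<subseteq> {z. n \<bullet> z = n \<bullet> y}"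
      using normal_cone_constant_on_face[OF cX assms(2,3) that(2)] by blast
    then have "affine hull G \<subseteq> {z. n \<bullet> z = n \<bullet> y}"
      by (simp add: hull_minimal affine_hyperplane)
    then show ?thesis
      using that(1) by (auto simp: inner_add_right)
  qed
  moreover have "y + u \<in> affine hull G" if u: "\<forall>n\<in>normal_cone X y. n \<bullet> u = 0" for u
  proof -
    obtain e where e: "e > 0" "y + e *\<^sub>R u \<in> X"
      using polyhedron_feasible_direction[OF assms(1) yX, of u] u by auto
    moreover have "carrier_face X y = G"
      using assms carrier_face_unique by blast
    ultimately have "y + e *\<^sub>R u \<in> G"
      using u by (auto simp: carrier_face_def)
    then have "e *\<^sub>R u \<in> tangent_space G"
      by (simp add: eq hull_inc)
    then have "(1 - 1/e) *\<^sub>R y + (1/e) *\<^sub>R (y + e *\<^sub>R u) \<in> affine hull G"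
      using yG by (intro mem_affine affine_affine_hull) (auto simp: eq hull_inc)
    then show ?thesis
      using e(1) by (simp add: algebra_simps)
  qed
  ultimately show ?thesis
    unfolding eq by blast
qed

lemma subspace_tangent_space:
  assumes "y \<in> F"
  shows "subspace (tangent_space F)"
proof -
  have "tangent_space F = (\<lambda>x. (-y) + x) ` (affine hull F)"
    using assms by (force simp: tangent_space_eq[OF hull_inc] image_iff)
  then show ?thesis
    using assms affine_diffs_subspace[OF affine_affine_hull, of y F] by (simp add: hull_inc)
qed

lemma aff_dim_eq_dim_tangent_space:
  fixes F :: "'a::euclidean_space set"
  assumes "y \<in> F"
  shows "aff_dim F = int (dim (tangent_space F))"
proof -
  have "tangent_space F = (+) (-y) ` (affine hull F)"
    using assms by (force simp: tangent_space_eq[OF hull_inc] image_iff)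
  moreover have "aff_dim (affine hull F) = int (dim ((+) (-y) ` (affine hull F)))"
    using assms by (intro aff_dim_eq_dim) (simp add: hull_inc)
  ultimately show ?thesis
    by simp
qed

text \<open>Since \<open>y + \<epsilon> v\<close> is the midpoint of two points of \<open>X\<close>, a functional that is maximal there is
constant along the whole segment.\<close>

lemma normal_cone_after_step:
  fixes X :: "'a::euclidean_space set"
  assumes "y + (2 * \<epsilon>) *\<^sub>R v \<in> X" "y \<in> X" "\<epsilon> > 0"
  shows "normal_cone X (y + \<epsilon> *\<^sub>R v) = {m \<in> normal_cone X y. m \<bullet> v = 0}"
proof (intro set_eqI iffI)
  fix m assume m: "m \<in> normal_cone X (y + \<epsilon> *\<^sub>R v)"
  have "(y - (y + \<epsilon> *\<^sub>R v)) \<bullet> m \<le> 0" "(y + (2 * \<epsilon>) *\<^sub>R v - (y + \<epsilon> *\<^sub>R v)) \<bullet> m \<le> 0"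
    using m assms unfolding normal_cone_def by blast+
  then have "\<epsilon> * (v \<bullet> m) = 0"
    by (simp add: algebra_simps)
  then have "m \<bullet> v = 0"
    using assms by (simp add: inner_commute)
  then show "m \<in> {m \<in> normal_cone X y. m \<bullet> v = 0}"
    using m by (auto simp: normal_cone_iff inner_add_right)
qed (auto simp: normal_cone_iff inner_add_right)

text \<open>The relatively open faces given by half-space presentations are the relative interiors of the
nonempty proper faces in the sense of \<open>face_of\<close>, whatever the presentation. The empty set of hyperplanes
gives no face: the frontier of a bounded set with interior points has the whole space as its
affine hull and contains no ball.\<close>

lemma is_face_iff:
  fixes X :: "'a::euclidean_space set"
  assumes "polyhedron X" "bounded X" "interior X \<noteq> {}"
  shows "is_face k X F \<longleftrightarrow> (\<exists>G. G face_of X \<and> G \<noteq> X \<and> F = rel_interior G \<and> aff_dim G = int k)"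
proof -
  have clX: "closed X" and cX: "convex X"
    using assms polyhedron_imp_closed polyhedron_imp_convex by blast+
  have frX: "frontier X = X - interior X"
    using clX by (simp add: frontier_def)
  have aff_X: "affine hull X = UNIV"
    using assms affine_hull_nonempty_interior by blast
  show ?thesis
  proof
    assume "is_face k X F"
    then obtain H S where H: "halfspace_presentation H X" "S \<subseteq> H" "aff_dim F = int k"
      and F: "F = rel_interior (frontier X \<inter> (\<Inter>h\<in>S. frontier h))"
      by (auto simp: is_face_def)
    have "F \<noteq> {}"
      using H(3) by auto
    have "S \<noteq> {}"
    proof
      assume "S = {}"
      then obtain z where z: "z \<in> rel_interior (frontier X)"
        using F \<open>F \<noteq> {}\<close> by auto
      have "X = convex hull (frontier X)"
        using assms(2) clX cX by (simp add: Krein_Milman_frontier compact_eq_bounded_closed)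
      then have "affine hull (frontier X) = UNIV"
        using aff_X by (metis affine_hull_convex_hull)
      then have "z \<in> interior (frontier X)"
        using z rel_interior_interior by blast
      then show False
        using frX interior_mono[of "frontier X" X] interior_subset by blast
    qed
    let ?G = "frontier X \<inter> (\<Inter>h\<in>S. frontier h)"
    have face1: "(X \<inter> frontier h) face_of X \<and> X \<inter> frontier h \<subseteq> frontier X" if "h \<in> S" for h
    proof -
      have "h \<in> H"
        using H(2) that by blast
      then have "\<exists>a b. a \<noteq> 0 \<and> h = {x. a \<bullet> x \<le> b}"
        using H(1) by (simp add: halfspace_presentation_def)
      then obtain a b where ab: "a \<noteq> 0" "h = {x. a \<bullet> x \<le> b}"
        by auto
      have "X \<subseteq> h"
        using H(1) \<open>h \<in> H\<close> by (simp add: halfspace_presentation_def Inter_lower)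
      then have "(X \<inter> frontier h) face_of X"
        using ab by (simp add: frontier_halfspace_le face_of_Int_supporting_hyperplane_le cX subset_iff)
      moreover have "X \<inter> frontier h \<subseteq> frontier X"
        using frX interior_mono[OF \<open>X \<subseteq> h\<close>] by (auto simp: frontier_def)
      ultimately show ?thesis
        by blast
    qed
    have G: "?G = (\<Inter>h\<in>S. X \<inter> frontier h)"
      using face1 \<open>S \<noteq> {}\<close> frX by blast
    have "?G face_of X"
      unfolding G using face1 \<open>S \<noteq> {}\<close> by (intro face_of_Inter) auto
    moreover have "?G \<noteq> X"
      using frX assms(3) interior_subset by blast
    moreover have "aff_dim ?G = int k"
      using H(3) F rel_interior_aff_dim face_of_imp_convex[OF \<open>?G face_of X\<close>] by metis
    ultimately show "\<exists>G. G face_of X \<and> G \<noteq> X \<and> F = rel_interior G \<and> aff_dim G = int k"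
      using F by blast
  next
    assume "\<exists>G. G face_of X \<and> G \<noteq> X \<and> F = rel_interior G \<and> aff_dim G = int k"
    then obtain G where G: "G face_of X" "G \<noteq> X" "F = rel_interior G" "aff_dim G = int k"
      by blast
    have "G \<noteq> {}"
      using G(4) by auto
    have GfrX: "G \<subseteq> frontier X"
      using face_of_subset_rel_boundary[OF G(1,2)] frX aff_X rel_interior_interior by blast
    obtain H where H: "finite H" "X = affine hull X \<inter> \<Inter>H"
      "\<forall>h\<in>H. \<exists>a b. a \<noteq> 0 \<and> h = {x. a \<bullet> x \<le> b}" "\<forall>H'. H' \<subset> H \<longrightarrow> X \<subset> affine hull X \<inter> \<Inter>H'"
      using assms(1) unfolding polyhedron_Int_affine_minimal by blast
    then obtain a b where ab: "\<And>h. h \<in> H \<Longrightarrow> a h \<noteq> 0 \<and> h = {x. a h \<bullet> x \<le> b h}"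
      by metis
    have pres: "halfspace_presentation H X"
      using H aff_X by (simp add: halfspace_presentation_def)
    define S where "S = {h \<in> H. G \<subseteq> X \<inter> {x. a h \<bullet> x = b h}}"
    have fr: "frontier h = {x. a h \<bullet> x = b h}" if "h \<in> H" for h
      using ab[OF that] frontier_halfspace_le by metis
    have "G = \<Inter>{X \<inter> {x. a h \<bullet> x = b h} |h. h \<in> H \<and> G \<subseteq> X \<inter> {x. a h \<bullet> x = b h}}"
      using H G \<open>G \<noteq> {}\<close> by (intro face_of_polyhedron_explicit[OF H(1,2) ab]) auto
    also have "\<dots> = (\<Inter>h\<in>S. X \<inter> frontier h)"
      by (intro arg_cong[of _ _ Inter]) (auto simp: S_def fr)
    finally have Geq: "G = (\<Inter>h\<in>S. X \<inter> frontier h)" .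
    have "S \<noteq> {}"
    proof
      assume "S = {}"
      then have "G = UNIV" using Geq by simp
      then show False using GfrX frX assms(3) interior_subset by blast
    qed
    then have "G = frontier X \<inter> (\<Inter>h\<in>S. frontier h)"
      using Geq GfrX frX by blast
    moreover have "F \<subseteq> frontier X"
      using G(3) GfrX rel_interior_subset by blast
    moreover have "aff_dim F = int k"
      using G rel_interior_aff_dim face_of_imp_convex by metis
    moreover have "S \<subseteq> H"
      by (auto simp: S_def)
    ultimately show "is_face k X F"
      unfolding is_face_def using pres G(3) by metis
  qed
qed


section \<open>The symplectic form and Reeb cones\<close>

lemma omega0_eq_inner: "omega0 u v = (\<i> *s u) \<bullet> v"
  by (simp add: omega0_def inner_vec_def inner_complex_def)

lemma inner_i_skew: "(\<i> *s u) \<bullet> v = - (u \<bullet> (\<i> *s (v :: complex ^ 2)))"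
  by (simp add: inner_vec_def inner_complex_def sum_2 algebra_simps)

lemma inner_i_self [simp]: "u \<bullet> (\<i> *s u) = 0" for u :: "complex ^ 2"
  using inner_i_skew[of u u] by (simp add: inner_commute)

lemma linear_i_smult: "linear (\<lambda>v :: complex ^ 2. \<i> *s v)"
  by (intro linearI) (simp_all add: vec_eq_iff algebra_simps)

lemma i_smult_scaleR: "\<i> *s (c *\<^sub>R v) = c *\<^sub>R (\<i> *s (v :: complex ^ 2))"
  using linear_i_smult by (rule linear_scale)

lemma i_smult_add: "\<i> *s (u + v) = \<i> *s u + \<i> *s (v :: complex ^ 2)"
  using linear_i_smult by (rule linear_add)

lemma i_smult_eq_0_iff [simp]: "\<i> *s u = 0 \<longleftrightarrow> u = 0" for u :: "complex ^ 2"
  by (simp add: vec_eq_iff)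

text \<open>By polarity, membership in the Reeb cone is a condition on the normal cone alone. As
\<open>m \<bullet> (\<i> *s n) = omega0 n m\<close>, it asks for a normal vector \<open>n\<close> with \<open>omega0 n m \<le> 0\<close> for all
normal vectors \<open>m\<close>.\<close>

lemma reeb_cone_eq:
  assumes "convex X" "y \<in> X"
  shows "reeb_cone X y = {\<i> *s n | n. n \<in> normal_cone X y \<and> (\<forall>m\<in>normal_cone X y. m \<bullet> (\<i> *s n) \<le> 0)}"
  unfolding reeb_cone_def tangent_cone_eq_polar[OF assms] by blast

lemma normal_cone_scaleR: "n \<in> normal_cone X y \<Longrightarrow> 0 \<le> c \<Longrightarrow> c *\<^sub>R n \<in> normal_cone X y"
  by (auto simp: normal_cone_iff mult_left_mono)

text \<open>Testing a normal vector against the point of the ball in its own direction. The linear functional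
given by \<open>y\<close> is thus positive on all nonzero normal vectors, which makes the normal cone pointed
and gives it a compact base.\<close>

lemma normal_cone_norm_le:
  fixes X :: "'a::euclidean_space set"
  assumes "cball 0 e \<subseteq> X" "e > 0" "n \<in> normal_cone X y"
  shows "e * norm n \<le> n \<bullet> y"
proof (cases "n = 0")
  case False
  have "(e / norm n) *\<^sub>R n \<in> X"
    using assms False by (intro subsetD[OF assms(1)]) simp
  then have "n \<bullet> ((e / norm n) *\<^sub>R n) \<le> n \<bullet> y"
    using assms(3) by (simp only: normal_cone_iff)
  then show ?thesis
    using False by (simp add: dot_square_norm power2_eq_square)
qed simp

lemma normal_cone_inner_pos:
  fixes X :: "'a::euclidean_space set"
  assumes "0 \<in> interior X" "n \<in> normal_cone X y" "n \<noteq> 0"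
  shows "n \<bullet> y > 0"
proof -
  obtain e where e: "e > 0" "cball 0 e \<subseteq> X"
    using assms(1) by (auto simp: mem_interior_cball)
  then have "e * norm n \<le> n \<bullet> y"
    using normal_cone_norm_le assms(2) by blast
  moreover have "0 < e * norm n"
    using e assms(3) by simp
  ultimately show ?thesis
    by linarith
qed

lemma normal_cone_collinear:
  fixes X :: "'a::euclidean_space set"
  assumes "0 \<in> interior X" "n \<in> normal_cone X y" "n \<noteq> 0" "m \<in> normal_cone X y" "m \<noteq> 0" "m \<in> span {n}"
  obtains c where "c > 0" "m = c *\<^sub>R n"
proof -
  obtain c where c: "m = c *\<^sub>R n"
    using assms(6) by (auto simp: span_singleton)
  have "n \<bullet> y > 0" "m \<bullet> y > 0"
    using assms normal_cone_inner_pos by blast+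
  then have "c > 0"
    by (simp add: c zero_less_mult_iff)
  then show thesis
    using that c by blast
qed

lemma normal_cone_nontrivial:
  fixes X :: "'a::euclidean_space set"
  assumes "convex X" "0 \<in> interior X" "y \<in> X" "y \<notin> interior X"
  obtains n where "n \<in> normal_cone X y" "n \<noteq> 0"
proof -
  have "y \<notin> rel_interior X"
    using assms rel_interior_nonempty_interior[of X] by auto
  then obtain a where a: "a \<noteq> 0" "\<And>x. x \<in> X \<Longrightarrow> a \<bullet> y \<le> a \<bullet> x"
    using supporting_hyperplane_rel_boundary[OF assms(1,3)] by metis
  show thesis
    by (rule that[of "- a"]) (use a in \<open>auto simp: normal_cone_iff\<close>)
qed

section \<open>Reeb cones are rays\<close>

text \<open>The rotated base of the normal cone is compact and convex. If it missed the tangent cone \<open>T\<close>, a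
hyperplane would separate them; as \<open>T\<close> is a cone, the normal \<open>- a\<close> of that hyperplane is polar to
\<open>T\<close>, hence a multiple of a vector of the base, and is strictly positive on the rotated base. But it is
orthogonal to its own rotation, because \<open>omega0\<close> is skew. This is the minimax theorem for
symmetric games, in which both players have the same strategies and the value is zero.\<close>

lemma reeb_cone_nontrivial:
  fixes X :: "(complex ^ 2) set"
  assumes "convex X" "0 \<in> interior X" "y \<in> X" "y \<notin> interior X"
  obtains n where "n \<in> normal_cone X y" "n \<noteq> 0" "\<forall>m\<in>normal_cone X y. m \<bullet> (\<i> *s n) \<le> 0"
proof -
  define N where "N = normal_cone X y"
  define T where "T = {v. \<forall>n\<in>N. n \<bullet> v \<le> 0}"
  define B where "B = {n\<in>N. n \<bullet> y = 1}"
  obtain e where e: "e > 0" "cball 0 e \<subseteq> X"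
    using assms(2) by (auto simp: mem_interior_cball)
  have pos: "n \<bullet> y > 0" if "n \<in> N" "n \<noteq> 0" for n
    using that assms(2) normal_cone_inner_pos unfolding N_def by blast
  have scale_B: "(1 / (n \<bullet> y)) *\<^sub>R n \<in> B" if "n \<in> N" "n \<noteq> 0" for n
    using that pos[OF that] by (auto simp: B_def N_def intro: normal_cone_scaleR)
  have "B = (\<Inter>x\<in>X. {n. (x - y) \<bullet> n \<le> 0}) \<inter> {n. y \<bullet> n = 1}"
    by (auto simp: B_def N_def normal_cone_def inner_commute)
  then have "closed B" "convex B"
    by (auto intro!: closed_Int closed_INT convex_Int convex_INT closed_halfspace_le
        convex_halfspace_le closed_hyperplane convex_hyperplane)
  moreover have "bounded B"
  proof (rule boundedI)
    fix n assume "n \<in> B"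
    then show "norm n \<le> 1 / e"
      using normal_cone_norm_le[OF e(2,1), of n y] e(1) by (simp add: B_def N_def field_simps)
  qed
  ultimately have "compact B" "convex B"
    by (simp_all add: compact_eq_bounded_closed)
  then have C: "compact ((\<lambda>v. \<i> *s v) ` B)" "convex ((\<lambda>v. \<i> *s v) ` B)"
    using linear_i_smult linear_continuous_on[of "\<lambda>v :: complex ^ 2. \<i> *s v" B]
    by (auto intro!: compact_continuous_image convex_linear_image simp: linear_conv_bounded_linear)
  have "B \<noteq> {}"
    using normal_cone_nontrivial[OF assms] scale_B unfolding N_def by (metis empty_iff)
  have "T = (\<Inter>n\<in>N. {v. n \<bullet> v \<le> 0})"
    by (auto simp: T_def)
  then have T: "closed T" "convex T"
    by (auto intro!: closed_INT convex_INT closed_halfspace_le convex_halfspace_le)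
  have "0 \<in> T"
    by (simp add: T_def)
  have "(\<lambda>v. \<i> *s v) ` B \<inter> T \<noteq> {}"
  proof
    assume "(\<lambda>v. \<i> *s v) ` B \<inter> T = {}"
    then obtain a b where a: "\<And>n. n \<in> B \<Longrightarrow> a \<bullet> (\<i> *s n) < b" and b: "\<And>v. v \<in> T \<Longrightarrow> b < a \<bullet> v"
      using separating_hyperplane_compact_closed[OF C(2,1) _ T(2,1)] \<open>B \<noteq> {}\<close>
      by (metis image_eqI image_is_empty)
    have "b < 0"
      using b[OF \<open>0 \<in> T\<close>] by simp
    have "a \<bullet> v \<ge> 0" if "v \<in> T" for v
    proof (rule ccontr)
      assume neg: "\<not> a \<bullet> v \<ge> 0"
      define t where "t = b / (a \<bullet> v)"
      have "t > 0"
        using neg \<open>b < 0\<close> by (simp add: t_def divide_neg_neg)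
      then have "t *\<^sub>R v \<in> T"
        using that by (simp add: T_def mult_le_0_iff)
      then have "b < a \<bullet> (t *\<^sub>R v)"
        by (rule b)
      then show False
        using neg by (simp add: t_def)
    qed
    moreover have "x - y \<in> T" if "x \<in> X" for x
      using that by (simp add: T_def N_def normal_cone_iff inner_diff_right)
    ultimately have aN: "- a \<in> N"
      by (force simp: N_def normal_cone_iff inner_diff_right)
    have "a \<noteq> 0"
      using a \<open>B \<noteq> {}\<close> \<open>b < 0\<close> by force
    then have "a \<bullet> (\<i> *s ((1 / ((- a) \<bullet> y)) *\<^sub>R (- a))) < b"
      using aN by (intro a scale_B) auto
    also have "(1 / ((- a) \<bullet> y)) *\<^sub>R (- a) = (1 / (a \<bullet> y)) *\<^sub>R a"
      by simp
    finally have "0 < b"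
      by (simp only: i_smult_scaleR inner_scaleR_right inner_i_self mult_zero_right)
    then show False
      using \<open>b < 0\<close> by linarith
  qed
  then obtain n where "n \<in> B" "\<i> *s n \<in> T"
    by blast
  then show thesis
    using that[of n] by (cases "n = 0") (auto simp: B_def T_def N_def)
qed

lemma dim_orthogonal_pair:
  fixes n m :: "'a::euclidean_space"
  assumes "n \<noteq> 0" "m \<notin> span {n}"
  shows "dim {u. n \<bullet> u = 0 \<and> m \<bullet> u = 0} + 2 = DIM('a)"
proof -
  have ind: "independent {m, n}" "m \<noteq> n"
    using assms by (auto simp: independent_insert span_base)
  then have "dim (span {m, n}) = 2"
    by (simp add: dim_eq_card_independent)
  moreover have "{u. n \<bullet> u = 0 \<and> m \<bullet> u = 0} = {u \<in> UNIV. \<forall>x\<in>span {m, n}. orthogonal x u}"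
  proof (intro set_eqI iffI)
    fix u assume u: "u \<in> {u. n \<bullet> u = 0 \<and> m \<bullet> u = 0}"
    have "orthogonal u x" if "x \<in> span {m, n}" for x
      using that by (rule orthogonal_to_span) (use u in \<open>auto simp: orthogonal_def inner_commute\<close>)
    then show "u \<in> {u \<in> UNIV. \<forall>x\<in>span {m, n}. orthogonal x u}"
      by (simp add: orthogonal_commute)
  qed (auto simp: orthogonal_def span_base)
  ultimately show ?thesis
    using dim_subspace_orthogonal_to_vectors[of "span {m, n}" UNIV] by simp
qed

lemma symplectic_polytopeD:
  assumes "symplectic_polytope X"
  shows "polyhedron X" "bounded X" "convex X" "closed X" "0 \<in> interior X" "interior X \<noteq> {}" "aff_dim X = 4"
proof -
  show "polyhedron X" "bounded X" "0 \<in> interior X"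
    using assms by (auto simp: symplectic_polytope_def convex_polytope_def compact_imp_bounded)
  then show "convex X" "closed X" "interior X \<noteq> {}"
    by (auto simp: polyhedron_imp_convex polyhedron_imp_closed)
  then show "aff_dim X = 4"
    using aff_dim_nonempty_interior[of X] by simp
qed

lemma proper_face_not_interior:
  assumes "symplectic_polytope X" "G face_of X" "G \<noteq> X" "y \<in> G"
  shows "y \<in> X" "y \<notin> interior X"
proof -
  show "y \<in> X"
    using assms face_of_imp_subset by blast
  show "y \<notin> interior X"
    using face_of_disjoint_interior[OF assms(2,3)] assms(4) by blast
qed

text \<open>On a plane a skew form that is not zero is nondegenerate.\<close>

lemma two_face_omega0_nondegenerate:
  assumes X: "symplectic_polytope X" and G: "G face_of X" "aff_dim G = 2"
    and v: "v \<in> tangent_space G" "v \<noteq> 0"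
  obtains w where "w \<in> tangent_space G" "omega0 v w \<noteq> 0"
proof (rule ccontr)
  assume "\<not> thesis"
  with that have degen: "\<And>w. w \<in> tangent_space G \<Longrightarrow> omega0 v w = 0"
    by blast
  note X' = symplectic_polytopeD[OF X]
  have cG: "convex G"
    using G face_of_imp_convex by blast
  have "G \<noteq> X"
    using X'(7) G(2) by auto
  then have "is_face 2 X (rel_interior G)"
    using G is_face_iff[OF X'(1,2,6)] by auto
  then obtain p q where pq: "p \<in> tangent_space G" "q \<in> tangent_space G" "omega0 p q \<noteq> 0"
    using X cG unfolding symplectic_polytope_def by (metis tangent_space_rel_interior)
  have "p \<noteq> 0"
    using pq(3) by (auto simp: omega0_eq_inner)
  moreover have "q \<notin> span {p}"
    using pq(3) by (auto simp: omega0_eq_inner span_singleton inner_commute)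
  ultimately have "independent {q, p}" "q \<noteq> p"
    by (auto simp: independent_insert span_base)
  moreover have "G \<noteq> {}"
    using G(2) by auto
  then obtain g where "g \<in> G"
    by blast
  then have "dim (tangent_space G) = 2"
    using aff_dim_eq_dim_tangent_space[of g G] G(2) by simp
  ultimately have "tangent_space G \<subseteq> span {q, p}"
    using pq by (intro card_ge_dim_independent) auto
  then obtain \<alpha> \<beta> where ab: "v = \<alpha> *\<^sub>R q + \<beta> *\<^sub>R p"
    using v(1) by (force simp: span_insert span_singleton algebra_simps)
  have "omega0 q p = - omega0 p q" "omega0 q q = 0" "omega0 p p = 0"
    using inner_i_skew[of q p] by (simp_all add: omega0_eq_inner inner_commute)
  then have "omega0 v p = - \<alpha> * omega0 p q" "omega0 v q = \<beta> * omega0 p q"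
    by (simp_all add: ab omega0_eq_inner i_smult_add i_smult_scaleR inner_add_left)
  then have "\<alpha> = 0" "\<beta> = 0"
    using degen pq by auto
  then show False
    using v(2) ab by simp
qed

text \<open>The place where the symplectic hypothesis enters. The plane of a 2-face is orthogonal to \<open>n\<close>, and
\<open>omega0 (\<i> *s n) w = - (n \<bullet> w)\<close>, so \<open>\<i> *s n\<close> in that plane would be a degenerate direction.\<close>

lemma reeb_direction_not_in_two_face:
  assumes X: "symplectic_polytope X" and G: "G face_of X" "aff_dim G = 2" "z \<in> rel_interior G"
    and n: "n \<in> normal_cone X z" "n \<noteq> 0"
  shows "\<i> *s n \<notin> tangent_space G"
proof
  assume "\<i> *s n \<in> tangent_space G"
  then obtain w where w: "w \<in> tangent_space G" "omega0 (\<i> *s n) w \<noteq> 0"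
    using two_face_omega0_nondegenerate[OF X G(1,2)] n(2) by (metis i_smult_eq_0_iff)
  then have "n \<bullet> w = 0"
    using tangent_space_eq_normal_cone_orthogonal[OF symplectic_polytopeD(1)[OF X] G(1,3)] n by blast
  with w(2) show False
    by (simp add: omega0_eq_inner)
qed

lemma normal_cone_step:
  fixes X :: "'a::euclidean_space set"
  assumes "polyhedron X" "y \<in> X" "\<forall>m\<in>normal_cone X y. m \<bullet> v \<le> 0"
  obtains \<epsilon> where "\<epsilon> > 0" "y + \<epsilon> *\<^sub>R v \<in> X"
    "normal_cone X (y + \<epsilon> *\<^sub>R v) = {m \<in> normal_cone X y. m \<bullet> v = 0}"
proof -
  obtain \<delta> where d: "\<delta> > 0" "y + \<delta> *\<^sub>R v \<in> X"
    using polyhedron_feasible_direction[OF assms] by blast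
  have "(1/2) *\<^sub>R y + (1/2) *\<^sub>R (y + \<delta> *\<^sub>R v) \<in> X"
    using assms d polyhedron_imp_convex by (intro convexD) auto
  moreover have "(1/2) *\<^sub>R y + (1/2) *\<^sub>R (y + \<delta> *\<^sub>R v) = y + (\<delta>/2) *\<^sub>R v"
    by (simp add: algebra_simps flip: scaleR_add_left)
  ultimately show thesis
    using d assms(2) that[of "\<delta>/2"] normal_cone_after_step[of y "\<delta>/2" v X] by simp
qed

text \<open>Two independent solutions \<open>n\<close>, \<open>m\<close> satisfy \<open>omega0 n m = 0\<close>. A short step in the direction
\<open>\<i> *s (n + m)\<close> leaves only normals orthogonal to both \<open>\<i> *s n\<close> and \<open>\<i> *s m\<close>, among them \<open>n\<close>
and \<open>m\<close> themselves. So the step ends in a face whose tangent space contains the plane spanned by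
the two rotated vectors and is contained in the orthogonal complement of \<open>n\<close> and \<open>m\<close>, also a plane:
a 2-face tangent to \<open>\<i> *s n\<close>.\<close>

lemma reeb_direction_unique:
  assumes X: "symplectic_polytope X" and y: "y \<in> X"
    and n: "n \<in> normal_cone X y" "n \<noteq> 0" "\<forall>k\<in>normal_cone X y. k \<bullet> (\<i> *s n) \<le> 0"
    and m: "m \<in> normal_cone X y" "m \<noteq> 0" "\<forall>k\<in>normal_cone X y. k \<bullet> (\<i> *s m) \<le> 0"
  obtains c where "c > 0" "m = c *\<^sub>R n"
proof -
  note X' = symplectic_polytopeD[OF X]
  have "m \<in> span {n}"
  proof (rule ccontr)
    assume indep: "m \<notin> span {n}"
    \<comment> \<open>Both products are at most zero, and they add up to zero by skewness.\<close>
    have nm: "n \<bullet> (\<i> *s m) = 0" "m \<bullet> (\<i> *s n) = 0"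
      using n m inner_i_skew[of n m] inner_commute[of "\<i> *s n" m] by fastforce+
    let ?v = "\<i> *s (n + m)"
    have v: "k \<bullet> ?v = k \<bullet> (\<i> *s n) + k \<bullet> (\<i> *s m)" for k
      by (simp add: i_smult_add inner_add_right)
    have "\<forall>k\<in>normal_cone X y. k \<bullet> ?v \<le> 0"
      using n(3) m(3) unfolding v by (simp add: add_nonpos_nonpos)
    then obtain \<epsilon> where e: "\<epsilon> > 0" "y + \<epsilon> *\<^sub>R ?v \<in> X"
      and N: "normal_cone X (y + \<epsilon> *\<^sub>R ?v) = {k \<in> normal_cone X y. k \<bullet> ?v = 0}"
      by (rule normal_cone_step[OF X'(1) y])
    define x where "x = y + \<epsilon> *\<^sub>R ?v"
    define G where "G = carrier_face X x"
    have G: "G face_of X" "x \<in> rel_interior G"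
      using carrier_face_face_of in_rel_interior_carrier_face e(2) X' by (auto simp: G_def x_def)
    \<comment> \<open>Two numbers that are at most zero and add up to zero both vanish.\<close>
    have N0: "k \<bullet> (\<i> *s n) = 0 \<and> k \<bullet> (\<i> *s m) = 0" if "k \<in> normal_cone X x" for k
      using that n(3) m(3) N v[of k] unfolding x_def by force
    have nN: "n \<in> normal_cone X x" "m \<in> normal_cone X x"
      using n m nm N unfolding x_def v by auto
    have T: "tangent_space G = {u. \<forall>k\<in>normal_cone X x. k \<bullet> u = 0}"
      using tangent_space_eq_normal_cone_orthogonal[OF X'(1) G] .
    have inT: "\<i> *s n \<in> tangent_space G" "\<i> *s m \<in> tangent_space G"
      using N0 T by auto
    have "dim (tangent_space G) \<le> dim {u. n \<bullet> u = 0 \<and> m \<bullet> u = 0}"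
      using T nN by (intro dim_subset) blast
    moreover have "dim {u. n \<bullet> u = 0 \<and> m \<bullet> u = 0} = 2"
      using dim_orthogonal_pair[OF n(2) indep] by simp
    moreover have "\<i> *s m \<notin> span {\<i> *s n}"
      using indep by (auto simp: span_singleton simp flip: i_smult_scaleR)
    then have "independent {\<i> *s m, \<i> *s n}" "\<i> *s m \<noteq> \<i> *s n"
      using n(2) by (auto simp: independent_insert span_base)
    then have "2 \<le> dim (tangent_space G)"
      using inT independent_card_le_dim[of "{\<i> *s m, \<i> *s n}" "tangent_space G"] by simp
    ultimately have "aff_dim G = 2"
      using aff_dim_eq_dim_tangent_space[of x G] G(2) rel_interior_subset[of G] by auto
    then show False
      using reeb_direction_not_in_two_face[OF X G(1) _ G(2) nN(1) n(2)] inT by blast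
  qed
  then show thesis
    using that normal_cone_collinear[OF X'(5) n(1,2) m(1,2)] by blast
qed

lemma reeb_cone_eq_ray:
  assumes X: "symplectic_polytope X" and y: "y \<in> X"
    and n: "n \<in> normal_cone X y" "n \<noteq> 0" "\<forall>k\<in>normal_cone X y. k \<bullet> (\<i> *s n) \<le> 0"
  shows "reeb_cone X y = {t *\<^sub>R (\<i> *s n) | t. 0 \<le> t}"
proof (intro set_eqI iffI)
  note R = reeb_cone_eq[OF symplectic_polytopeD(3)[OF X] y]
  fix v
  show "v \<in> {t *\<^sub>R (\<i> *s n) | t. 0 \<le> t}" if "v \<in> reeb_cone X y"
  proof -
    obtain m where m: "v = \<i> *s m" "m \<in> normal_cone X y" "\<forall>k\<in>normal_cone X y. k \<bullet> (\<i> *s m) \<le> 0"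
      using \<open>v \<in> reeb_cone X y\<close> unfolding R by blast
    show ?thesis
    proof (cases "m = 0")
      case True
      then show ?thesis
        using m(1) by (auto intro!: exI[of _ 0])
    next
      case False
      then obtain c where "c > 0" "m = c *\<^sub>R n"
        using reeb_direction_unique[OF X y n m(2) _ m(3)] by blast
      then show ?thesis
        using m(1) by (auto simp: i_smult_scaleR intro!: exI[of _ c])
    qed
  qed
  show "v \<in> reeb_cone X y" if v: "v \<in> {t *\<^sub>R (\<i> *s n) | t. 0 \<le> t}"
  proof -
    obtain t where t: "0 \<le> t" "v = \<i> *s (t *\<^sub>R n)"
      using v unfolding i_smult_scaleR by blast
    moreover have "t *\<^sub>R n \<in> normal_cone X y"
      using n(1) t(1) by (rule normal_cone_scaleR)
    moreover have "\<forall>k\<in>normal_cone X y. k \<bullet> (\<i> *s (t *\<^sub>R n)) \<le> 0"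
      using n(3) t(1) by (simp add: i_smult_scaleR mult_nonneg_nonpos)
    ultimately show ?thesis
      unfolding R by blast
  qed
qed

lemma face_reeb_cone_eq:
  assumes "convex X" "G face_of X" "y \<in> rel_interior G"
  shows "face_reeb_cone X (rel_interior G) = reeb_cone X y"
  unfolding face_reeb_cone_def
proof (rule value_on_eq[OF assms(3)])
  fix z assume "z \<in> rel_interior G"
  then show "reeb_cone X z = reeb_cone X y"
    using tangent_cone_eq_on_rel_interior[OF assms(1,2) _ assms(3)]
      normal_cone_eq_on_rel_interior[OF assms(1,2) _ assms(3)]
    by (simp add: reeb_cone_def)
qed

section \<open>Following the Reeb direction\<close>

lemma is_ray_multiples: "v \<noteq> 0 \<Longrightarrow> is_ray {t *\<^sub>R v | t. 0 \<le> t}"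
  by (auto simp: is_ray_def)

text \<open>Near \<open>y + \<epsilon> v\<close> every point of the affine hull belongs to \<open>K\<close>, so every direction
of the tangent space near \<open>v\<close> is feasible for \<open>K\<close> at \<open>y\<close>.\<close>

lemma step_into_rel_interior_points_into:
  fixes K :: "'a::euclidean_space set"
  assumes K: "convex K" "closed K" and G: "G face_of K" "G \<noteq> K"
    and y: "y \<in> rel_interior G" and v: "v \<noteq> 0" "\<epsilon> > 0" "y + \<epsilon> *\<^sub>R v \<in> rel_interior K"
  shows "points_into {t *\<^sub>R v | t. 0 \<le> t} (rel_interior G) (rel_interior K)"
proof -
  have clK: "closure (rel_interior K) = K"
    using K by (simp add: convex_closure_rel_interior)
  have GK: "G \<subseteq> K" and cG: "convex G"
    using G face_of_imp_subset face_of_imp_convex by blast+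
  have yK: "y \<in> K"
    using y GK rel_interior_subset by blast
  have "rel_interior G \<noteq> rel_interior K"
    using face_of_disjoint_rel_interior[OF G] v(3) rel_interior_subset[of G] by blast
  have cone: "face_tangent_cone K (rel_interior G) = tangent_cone K y"
    unfolding face_tangent_cone_def
    using tangent_cone_eq_on_rel_interior[OF K(1) G(1) _ y] by (intro value_on_eq[OF y])
  have TS: "tangent_space (rel_interior K) = {u. y + u \<in> affine hull K}"
    using yK by (simp add: tangent_space_rel_interior[OF K(1)] tangent_space_eq hull_inc)
  have "w \<in> top_of_set (tangent_space (rel_interior K)) interior_of tangent_cone K y"
    if w: "w = t *\<^sub>R v" "t > 0" for w t
  proof -
    define \<delta> where "\<delta> = \<epsilon> / t"
    have d: "\<delta> > 0" "y + \<delta> *\<^sub>R w \<in> rel_interior K"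
      using w v by (auto simp: \<delta>_def)
    obtain e where e: "e > 0" "ball (y + \<delta> *\<^sub>R w) e \<inter> affine hull K \<subseteq> K"
      using d(2) by (auto simp: mem_rel_interior_ball)
    let ?U = "tangent_space (rel_interior K) \<inter> ball w (e / \<delta>)"
    have affine_move: "y + \<delta> *\<^sub>R u \<in> affine hull K" if "y + u \<in> affine hull K" for u \<delta>
    proof -
      have "(1 - \<delta>) *\<^sub>R y + \<delta> *\<^sub>R (y + u) \<in> affine hull K"
        using yK that by (intro mem_affine affine_affine_hull) (auto simp: hull_inc)
      then show ?thesis
        by (simp add: algebra_simps)
    qed
    have "u \<in> tangent_cone K y" if "u \<in> ?U" for u
    proof -
      have "y + \<delta> *\<^sub>R u \<in> affine hull K"
        using that by (auto simp: TS affine_move)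
      moreover have "dist (y + \<delta> *\<^sub>R w) (y + \<delta> *\<^sub>R u) = \<delta> * dist w u"
        using d(1) by (simp add: dist_norm flip: scaleR_diff_right)
      then have "y + \<delta> *\<^sub>R u \<in> ball (y + \<delta> *\<^sub>R w) e"
        using that d(1) by (simp add: field_simps)
      ultimately have "y + \<delta> *\<^sub>R u \<in> K"
        using e by blast
      then show ?thesis
        unfolding tangent_cone_def using d(1) by (intro subsetD[OF closure_subset]) auto
    qed
    moreover have "y + \<delta> *\<^sub>R w \<in> affine hull K"
      using d(2) rel_interior_subset[of K] by (simp add: hull_inc subsetD)
    then have "y + (1/\<delta>) *\<^sub>R (\<delta> *\<^sub>R w) \<in> affine hull K"
      by (rule affine_move)
    then have "w \<in> ?U"
      using d(1) e(1) by (simp add: TS)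
    moreover have "openin (top_of_set (tangent_space (rel_interior K))) ?U"
      by (intro openin_open_Int) simp
    ultimately show ?thesis
      unfolding interior_of_def by blast
  qed
  then have "\<forall>w\<in>{t *\<^sub>R v | t. 0 \<le> t}. w \<noteq> 0 \<longrightarrow>
      w \<in> top_of_set (tangent_space (rel_interior K)) interior_of tangent_cone K y"
    by (auto simp: order_le_less)
  then show ?thesis
    unfolding points_into_def clK cone
    using is_ray_multiples[OF v(1)] \<open>rel_interior G \<noteq> rel_interior K\<close>
      subset_trans[OF rel_interior_subset GK] by (intro conjI)
qed

text \<open>Starting in \<open>G\<close>, a short step along the Reeb direction \<open>\<i> *s n\<close> ends at a point \<open>x\<close> of some face
\<open>K\<close>. Its normals are the normals at \<open>y\<close> that are orthogonal to \<open>\<i> *s n\<close>; hence \<open>n\<close> is still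
normal, \<open>\<i> *s n\<close> is tangent to \<open>K\<close> and still a Reeb direction, and \<open>y\<close> lies in \<open>K\<close>. The dimension
of \<open>K\<close> is not 0, as \<open>K\<close> has a nonzero tangent vector, and not 2, as 2-faces have no tangent Reeb
direction.\<close>

lemma reeb_step:
  assumes X: "symplectic_polytope X" and G: "G face_of X" "G \<noteq> X" "G \<noteq> {}"
  obtains n x K where "n \<noteq> 0" "K face_of X" "K \<noteq> X" "G \<subseteq> K" "x \<in> rel_interior K"
    "n \<in> normal_cone X x" "\<i> *s n \<in> tangent_space K"
    "face_reeb_cone X (rel_interior G) = {t *\<^sub>R (\<i> *s n) | t. 0 \<le> t}"
    "face_reeb_cone X (rel_interior K) = {t *\<^sub>R (\<i> *s n) | t. 0 \<le> t}"
    "aff_dim K = 1 \<or> aff_dim K = 3"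
    "G \<noteq> K \<longrightarrow> points_into (face_reeb_cone X (rel_interior G)) (rel_interior G) (rel_interior K)"
proof -
  note X' = symplectic_polytopeD[OF X]
  obtain y where y: "y \<in> rel_interior G"
    using G rel_interior_eq_empty face_of_imp_convex by blast
  then have yG: "y \<in> G"
    using rel_interior_subset by blast
  note yX = proper_face_not_interior[OF X G(1,2) yG]
  obtain n where n: "n \<in> normal_cone X y" "n \<noteq> 0" "\<forall>m\<in>normal_cone X y. m \<bullet> (\<i> *s n) \<le> 0"
    using reeb_cone_nontrivial[OF X'(3,5) yX] by blast
  let ?v = "\<i> *s n"
  obtain \<epsilon> where e: "\<epsilon> > 0" "y + \<epsilon> *\<^sub>R ?v \<in> X"
    and N: "normal_cone X (y + \<epsilon> *\<^sub>R ?v) = {m \<in> normal_cone X y. m \<bullet> ?v = 0}"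
    by (rule normal_cone_step[OF X'(1) yX(1) n(3)])
  define x where "x = y + \<epsilon> *\<^sub>R ?v"
  define K where "K = carrier_face X x"
  have xX: "x \<in> X"
    using e by (simp add: x_def)
  have K: "K face_of X" "x \<in> rel_interior K"
    using carrier_face_face_of in_rel_interior_carrier_face xX X' by (auto simp: K_def)
  have nx: "n \<in> normal_cone X x" "\<forall>m\<in>normal_cone X x. m \<bullet> ?v = 0"
    using N n(1) by (auto simp: x_def)
  have T: "tangent_space K = {u. \<forall>m\<in>normal_cone X x. m \<bullet> u = 0}"
    using tangent_space_eq_normal_cone_orthogonal[OF X'(1) K] .
  have vT: "?v \<in> tangent_space K"
    using nx T by simp
  have "y \<in> K"
    using yX(1) nx(2) by (simp add: K_def carrier_face_def x_def)
  then have GK: "G \<subseteq> K"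
    using subset_of_face_of[OF K(1) face_of_imp_subset[OF G(1)]] y by blast
  have "x \<notin> interior X"
  proof
    assume "x \<in> interior X"
    then have "x \<in> rel_interior X"
      using interior_subset_rel_interior by blast
    then have "tangent_space X \<subseteq> {w. n \<bullet> w = 0}"
      using tangent_space_eq_normal_cone_orthogonal[OF X'(1) face_of_refl[OF X'(3)]] nx(1) by blast
    moreover have "n - 0 \<in> tangent_space X"
      unfolding tangent_space_def affine_hull_nonempty_interior[OF X'(6)] by blast
    ultimately show False
      using n(2) by auto
  qed
  then have KX: "K \<noteq> X"
    using K(2) rel_interior_nonempty_interior[OF X'(6)] by metis
  have dimK: "aff_dim K = int (dim (tangent_space K))"
    using K(2) rel_interior_subset by (intro aff_dim_eq_dim_tangent_space[of x]) blast
  moreover have "aff_dim K < 4"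
    using face_of_aff_dim_lt[OF X'(3) K(1) KX] X'(7) by simp
  moreover have "aff_dim K \<noteq> 2"
    using reeb_direction_not_in_two_face[OF X K(1) _ K(2) nx(1) n(2)] vT by blast
  moreover have "dim (tangent_space K) \<noteq> 0"
    using vT n(2) by (auto simp: dim_eq_0)
  ultimately have dims: "aff_dim K = 1 \<or> aff_dim K = 3"
    by linarith
  have RG: "face_reeb_cone X (rel_interior G) = {t *\<^sub>R ?v | t. 0 \<le> t}"
    using face_reeb_cone_eq[OF X'(3) G(1) y] reeb_cone_eq_ray[OF X yX(1) n] by simp
  have RK: "face_reeb_cone X (rel_interior K) = {t *\<^sub>R ?v | t. 0 \<le> t}"
    using face_reeb_cone_eq[OF X'(3) K] reeb_cone_eq_ray[OF X xX nx(1) n(2)] nx(2) by simp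
  have "points_into (face_reeb_cone X (rel_interior G)) (rel_interior G) (rel_interior K)" if "G \<noteq> K"
    unfolding RG
  proof (rule step_into_rel_interior_points_into)
    show "convex K" "closed K"
      using K X' face_of_imp_convex face_of_imp_closed by blast+
    show "G face_of K"
      using face_of_subset[OF G(1) GK face_of_imp_subset[OF K(1)]] .
  qed (use that y n(2) e(1) K(2) x_def in auto)
  then show thesis
    using that[OF n(2) K(1) KX GK K(2) nx(1) vT RG RK dims] by blast
qed

section \<open>The faces of a symplectic polytope\<close>

lemma adjacent_rel_interior_iff:
  fixes X :: "'a::euclidean_space set"
  assumes "convex X" "closed X" "G face_of X" "K face_of X"
  shows "adjacent (rel_interior G) (rel_interior K) \<longleftrightarrow> G \<subseteq> K \<and> G \<noteq> K"
proof -
  have G: "convex G" "closed G" and K: "convex K" "closed K"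
    using assms face_of_imp_convex face_of_imp_closed by blast+
  have "rel_interior G \<subseteq> closure (rel_interior K) \<longleftrightarrow> G \<subseteq> K"
    using G K closure_minimal[of "rel_interior G" K] rel_interior_subset[of G]
    by (auto simp: convex_closure_rel_interior)
  moreover have "aff_dim G < aff_dim K" if "G \<subseteq> K" "G \<noteq> K"
    using that assms face_of_aff_dim_lt[OF K(1)] face_of_subset face_of_imp_subset by metis
  ultimately show ?thesis
    using G(1) K(1) by (auto simp: adjacent_def rel_interior_aff_dim)
qed

text \<open>If the Reeb cone agreed with that of an adjacent 3-face \<open>Q\<close>, then \<open>n\<close> would be normal along \<open>Q\<close>,
hence also along a 2-face \<open>P\<close> lying between \<open>K\<close> and \<open>Q\<close>. But \<open>\<i> *s n\<close> is tangent to \<open>K\<close>, hence to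
\<open>P\<close>, which is impossible for a 2-face.\<close>

lemma tangent_reeb_direction_bad_1_face:
  assumes X: "symplectic_polytope X" and K: "K face_of X" "aff_dim K = 1" "x \<in> rel_interior K"
    and n: "n \<in> normal_cone X x" "n \<noteq> 0" "\<i> *s n \<in> tangent_space K"
    and R: "face_reeb_cone X (rel_interior K) = {t *\<^sub>R (\<i> *s n) | t. 0 \<le> t}"
  shows "bad_1_face X (rel_interior K)"
proof -
  note X' = symplectic_polytopeD[OF X]
  have cK: "convex K"
    using K face_of_imp_convex by blast
  have xK: "x \<in> K"
    using K rel_interior_subset by blast
  have "is_face 1 X (rel_interior K)"
    using K X'(7) is_face_iff[OF X'(1,2,6)] by auto
  moreover have "tangent_to (face_reeb_cone X (rel_interior K)) (rel_interior K)"
    unfolding tangent_to_def R tangent_space_rel_interior[OF cK]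
    using n(2,3) subspace_tangent_space[OF xK] by (auto intro: is_ray_multiples subspace_scale)
  moreover have "face_reeb_cone X (rel_interior K) \<noteq> face_reeb_cone X E"
    if E: "is_face 3 X E" "adjacent (rel_interior K) E" for E
  proof
    assume eq: "face_reeb_cone X (rel_interior K) = face_reeb_cone X E"
    obtain Q where Q: "Q face_of X" "E = rel_interior Q" "aff_dim Q = 3"
      using E(1) is_face_iff[OF X'(1,2,6)] by auto
    have KQ: "K \<subseteq> Q" "K \<noteq> Q"
      using E(2) Q adjacent_rel_interior_iff[OF X'(3,4) K(1) Q(1)] by auto
    obtain q where q: "q \<in> rel_interior Q"
      using Q(1) KQ(1) xK rel_interior_eq_empty[of Q] face_of_imp_convex[OF Q(1)] by blast
    have "1 *\<^sub>R (\<i> *s n) \<in> face_reeb_cone X E"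
      unfolding eq[symmetric] R by (rule CollectI) (rule exI[of _ 1], simp)
    then have "\<i> *s n \<in> reeb_cone X q"
      using face_reeb_cone_eq[OF X'(3) Q(1) q] Q(2) by simp
    then have nq: "n \<in> normal_cone X q"
      by (auto simp: reeb_cone_def)
    have "polyhedron Q" "K face_of Q"
      using face_of_polyhedron_polyhedron X'(1) Q(1) face_of_subset[OF K(1) KQ(1)]
        face_of_imp_subset by blast+
    then obtain P where P: "P facet_of Q" "K \<subseteq> P"
      using face_of_polyhedron_subset_facet[of Q K] KQ xK by blast
    then have P': "P face_of X" "aff_dim P = 2" "P \<subseteq> Q"
      using Q face_of_trans[of P Q X] face_of_imp_subset[of P Q] by (auto simp: facet_of_def)
    obtain p where p: "p \<in> rel_interior P"
      using P(2) xK rel_interior_eq_empty[of P] face_of_imp_convex[OF P'(1)] by blast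
    have "n \<in> normal_cone X p"
      using normal_cone_antimono_on_face[OF X'(3) Q(1) q, of p] nq p P'(3) rel_interior_subset by blast
    moreover have "tangent_space K \<subseteq> tangent_space P"
      using hull_mono[OF P(2)] by (auto simp: tangent_space_def)
    ultimately show False
      using reeb_direction_not_in_two_face[OF X P'(1,2) p _ n(2)] n(3) by blast
  qed
  ultimately show ?thesis
    by (simp add: bad_1_face_def)
qed

text \<open>The normal cone of a 3-face is a ray, for a second independent normal would confine the tangent
space to a plane. So the outward unit normal is well defined and the Reeb cone, being a ray contained in
the rotated normal cone, is spanned by its rotation.\<close>

lemma three_face_reeb_cone:
  assumes X: "symplectic_polytope X" and E: "is_face 3 X E"
  shows "face_reeb_cone X E = {t *\<^sub>R reeb_vector X E | t. 0 \<le> t}"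
proof -
  note X' = symplectic_polytopeD[OF X]
  obtain K where K: "K face_of X" "K \<noteq> X" "E = rel_interior K" "aff_dim K = 3"
    using E is_face_iff[OF X'(1,2,6)] by auto
  have cK: "convex K"
    using K face_of_imp_convex by blast
  have "K \<noteq> {}"
    using K(4) by auto
  then obtain y where y: "y \<in> rel_interior K"
    using cK rel_interior_eq_empty by blast
  then have yK: "y \<in> K"
    using rel_interior_subset by blast
  note yX = proper_face_not_interior[OF X K(1,2) yK]
  obtain n where n: "n \<in> normal_cone X y" "n \<noteq> 0" "\<forall>m\<in>normal_cone X y. m \<bullet> (\<i> *s n) \<le> 0"
    using reeb_cone_nontrivial[OF X'(3,5) yX] by blast
  have R: "face_reeb_cone X E = {t *\<^sub>R (\<i> *s n) | t. 0 \<le> t}"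
    using face_reeb_cone_eq[OF X'(3) K(1) y] reeb_cone_eq_ray[OF X yX(1) n] K(3) by simp
  have T: "tangent_space E = {u. \<forall>m\<in>normal_cone X y. m \<bullet> u = 0}"
    using tangent_space_eq_normal_cone_orthogonal[OF X'(1) K(1) y] K(3) tangent_space_rel_interior[OF cK]
    by simp
  have "dim (tangent_space E) = 3"
    using aff_dim_eq_dim_tangent_space[OF yK] K(3,4) tangent_space_rel_interior[OF cK] by simp
  have span_n: "m \<in> span {n}" if "m \<in> normal_cone X y" for m
  proof (rule ccontr)
    assume "m \<notin> span {n}"
    then have "dim {u. n \<bullet> u = 0 \<and> m \<bullet> u = 0} = 2"
      using dim_orthogonal_pair[OF n(2)] by simp
    moreover have "dim (tangent_space E) \<le> dim {u. n \<bullet> u = 0 \<and> m \<bullet> u = 0}"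
      using T that n(1) by (intro dim_subset) blast
    ultimately show False
      using \<open>dim (tangent_space E) = 3\<close> by simp
  qed
  define \<nu> where "\<nu> = (1 / norm n) *\<^sub>R n"
  have nN: "\<nu> \<in> normal_cone X y"
    using n(1) by (simp add: \<nu>_def normal_cone_scaleR)
  have const: "\<nu> \<bullet> z = \<nu> \<bullet> y" if "z \<in> E" for z
    using normal_cone_constant_on_face[OF X'(3) K(1) y nN] that K(3) rel_interior_subset by blast
  have out: "outward_unit_normal X E = \<nu>"
    unfolding outward_unit_normal_def
  proof (rule the_equality)
    show "norm \<nu> = 1 \<and> (\<forall>v\<in>tangent_space E. \<nu> \<bullet> v = 0) \<and> (\<forall>x\<in>X. \<forall>z\<in>E. \<nu> \<bullet> (x - z) \<le> 0)"
      using n(2) nN const T by (auto simp: \<nu>_def[symmetric] normal_cone_iff inner_diff_right) (simp add: \<nu>_def)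
  next
    fix \<mu> assume \<mu>: "norm \<mu> = 1 \<and> (\<forall>v\<in>tangent_space E. \<mu> \<bullet> v = 0) \<and> (\<forall>x\<in>X. \<forall>z\<in>E. \<mu> \<bullet> (x - z) \<le> 0)"
    then have "\<mu> \<in> normal_cone X y" "\<mu> \<noteq> 0"
      using y K(3) by (auto simp: normal_cone_iff inner_diff_right)
    then obtain c where "c > 0" "\<mu> = c *\<^sub>R n"
      using normal_cone_collinear[OF X'(5) n(1,2)] span_n by metis
    then show "\<mu> = \<nu>"
      using \<mu> n(2) by (simp add: \<nu>_def eq_divide_eq)
  qed
  have "\<nu> \<bullet> y > 0"
    using normal_cone_inner_pos[OF X'(5) nN] n(2) by (simp add: \<nu>_def)
  define c where "c = 2 / (\<nu> \<bullet> y) / norm n"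
  have "c > 0"
    using \<open>\<nu> \<bullet> y > 0\<close> n(2) by (simp add: c_def)
  have "reeb_vector X E = (2 / (\<nu> \<bullet> y)) *\<^sub>R (\<i> *s \<nu>)"
    unfolding reeb_vector_def out Let_def
  proof (rule value_on_eq)
    show "y \<in> E"
      using y K(3) by simp
  qed (simp add: const)
  also have "\<dots> = c *\<^sub>R (\<i> *s n)"
    by (simp add: \<nu>_def c_def i_smult_scaleR)
  finally have "reeb_vector X E = c *\<^sub>R (\<i> *s n)" .
  moreover have "{t *\<^sub>R (\<i> *s n) | t. 0 \<le> t} = {t *\<^sub>R (c *\<^sub>R (\<i> *s n)) | t. 0 \<le> t}"
  proof (intro set_eqI iffI; clarify)
    fix t :: real assume "0 \<le> t"
    then show "\<exists>s. t *\<^sub>R (\<i> *s n) = s *\<^sub>R c *\<^sub>R (\<i> *s n) \<and> 0 \<le> s"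
      using \<open>c > 0\<close> by (intro exI[of _ "t / c"]) auto
  next
    fix t :: real assume "0 \<le> t"
    then show "\<exists>s. t *\<^sub>R c *\<^sub>R (\<i> *s n) = s *\<^sub>R (\<i> *s n) \<and> 0 \<le> s"
      using \<open>c > 0\<close> by (intro exI[of _ "t * c"]) auto
  qed
  ultimately show ?thesis
    using R by simp
qed

text \<open>The trichotomy behind the low-dimensional cases, indexed by the face reached by the step: a
3-face, the face itself, or a 1-face. A larger face has larger dimension, so a 1-face is reached from
another face only if that face is a vertex; and the step stays in its own face only if that is a
1-face, since \<open>k < 3\<close>.\<close>

lemma reeb_cone_of_face:
  assumes X: "symplectic_polytope X" and F: "is_face k X F" "k < 3"
  obtains (three_face) E where "is_face 3 X E" "adjacent F E" "points_into (face_reeb_cone X F) F E"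
      "face_reeb_cone X F = face_reeb_cone X E"
    | (own) "k = 1" "bad_1_face X F"
    | (bad) L where "k = 0" "bad_1_face X L" "adjacent F L" "points_into (face_reeb_cone X F) F L"
      "face_reeb_cone X F = face_reeb_cone X L"
proof -
  note X' = symplectic_polytopeD[OF X]
  note face = is_face_iff[OF X'(1,2,6)]
  obtain G where G: "G face_of X" "G \<noteq> X" "F = rel_interior G" "aff_dim G = int k"
    using F face by auto
  have "G \<noteq> {}"
    using G(4) by auto
  obtain n x K where n: "n \<noteq> 0" and K: "K face_of X" "K \<noteq> X" and GK: "G \<subseteq> K" and x: "x \<in> rel_interior K"
    and nx: "n \<in> normal_cone X x" "\<i> *s n \<in> tangent_space K"
    and RG: "face_reeb_cone X F = {t *\<^sub>R (\<i> *s n) | t. 0 \<le> t}"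
    and RK: "face_reeb_cone X (rel_interior K) = {t *\<^sub>R (\<i> *s n) | t. 0 \<le> t}"
    and dimK: "aff_dim K = 1 \<or> aff_dim K = 3"
    and into: "G \<noteq> K \<longrightarrow> points_into (face_reeb_cone X F) F (rel_interior K)"
    by (rule reeb_step[OF X G(1,2) \<open>G \<noteq> {}\<close>, folded G(3)]) (rule that; assumption)
  have adj: "adjacent F (rel_interior K)" if "G \<noteq> K"
    using that GK G(3) adjacent_rel_interior_iff[OF X'(3,4) G(1) K(1)] by blast
  from dimK show thesis
  proof
    assume 3: "aff_dim K = 3"
    then have "G \<noteq> K" "is_face 3 X (rel_interior K)"
      using G(4) F(2) K face by auto
    then show thesis
      using three_face adj into RG RK by simp
  next
    assume 1: "aff_dim K = 1"
    then have bad_K: "bad_1_face X (rel_interior K)"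
      using tangent_reeb_direction_bad_1_face[OF X K(1) 1 x nx(1) n nx(2) RK] by blast
    show thesis
    proof (cases "G = K")
      case True
      then show thesis
        using own bad_K G 1 by simp
    next
      case False
      have "aff_dim G < aff_dim K"
        using adj[OF False] G(1,3) K(1) face_of_imp_convex[of G X] face_of_imp_convex[of K X]
        by (simp add: adjacent_def rel_interior_aff_dim)
      then have "k = 0"
        using 1 G(4) by simp
      then show thesis
        using bad bad_K adj[OF False] into False RG RK by simp
    qed
  qed
qed

theorem lemma1p7:
  fixes X :: "(complex ^ 2) set"
  assumes "symplectic_polytope X"
  shows "(\<forall>E. is_face 3 X E \<longrightarrow>
            face_reeb_cone X E = {t *\<^sub>R reeb_vector X E | t. 0 \<le> t}) \<and>
         (\<forall>F. is_face 2 X F \<longrightarrow>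
            (\<exists>E. is_face 3 X E \<and> adjacent F E \<and>
                 points_into (face_reeb_cone X F) F E \<and>
                 face_reeb_cone X F = face_reeb_cone X E)) \<and>
         (\<forall>L. is_face 1 X L \<longrightarrow> good_1_face X L \<or> bad_1_face X L) \<and>
         (\<forall>P. is_face 0 X P \<longrightarrow>
            (\<exists>E. is_face 3 X E \<and> adjacent P E \<and>
                 points_into (face_reeb_cone X P) P E \<and>
                 face_reeb_cone X P = face_reeb_cone X E) \<or>
            (\<exists>L. bad_1_face X L \<and> adjacent P L \<and>
                 points_into (face_reeb_cone X P) P L \<and>
                 face_reeb_cone X P = face_reeb_cone X L))"
proof (intro conjI allI impI)
  fix E assume "is_face 3 X E"
  then show "face_reeb_cone X E = {t *\<^sub>R reeb_vector X E | t. 0 \<le> t}"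
    by (rule three_face_reeb_cone[OF assms])
next
  fix F assume "is_face 2 X F"
  from reeb_cone_of_face[OF assms this] show "\<exists>E. is_face 3 X E \<and> adjacent F E \<and>
      points_into (face_reeb_cone X F) F E \<and> face_reeb_cone X F = face_reeb_cone X E"
    by (cases; force)
next
  fix L assume L: "is_face 1 X L"
  from reeb_cone_of_face[OF assms L] show "good_1_face X L \<or> bad_1_face X L"
    using L by (cases; force simp: good_1_face_def)
next
  fix P assume "is_face 0 X P"
  from reeb_cone_of_face[OF assms this]
  show "(\<exists>E. is_face 3 X E \<and> adjacent P E \<and> points_into (face_reeb_cone X P) P E \<and>
             face_reeb_cone X P = face_reeb_cone X E) \<or>
        (\<exists>L. bad_1_face X L \<and> adjacent P L \<and> points_into (face_reeb_cone X P) P L \<and>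
             face_reeb_cone X P = face_reeb_cone X L)"
    by (cases; force)
qed

end
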